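(* Let $n\ge 1$ be an integer and let $\mathbf{Q}_n = (q^{2n+1}_{k,l})_{0\le k,l\le 2n}$ be the $(2n+1)\times(2n+1)$ matrix (row index $k$, column index $l$) with entries $$q^{2n+1}_{k,l} = \begin{cases} (2n+1)^{-1/2} & l=0,\\ (2n+1)^{-1/2}\sqrt2\,\cos\left(\dfrac{lk\pi}{2n+1}\right) & l=2,4,\dots,2n,\\ (2n+1)^{-1/2}\sqrt2\,\sin\left(\dfrac{(l+1)k\pi}{2n+1}\right) & l=1,3,\dots,2n-1.\end{cases}$$ Then $\mathbf{Q}_n$ is an orthogonal matrix, and $$\mathbf{Q}_n\,\mathrm{diag}\left[2,\,2\cos\left(\tfrac{2\pi}{2n+1}\right),\,2\cos\left(\tfrac{2\pi}{2n+1}\right),\,\dots,\,2\cos\left(\tfrac{2n\pi}{2n+1}\right),\,2\cos\left(\tfrac{2n\pi}{2n+1}\right)\right]\mathbf{Q}_n^\top = \widetilde{J}_n,$$ where in the diagonal matrix the first entry is $2$ and each value $2\cos\left(\frac{2j\pi}{2n+1}\right)$, $j=1,\dots,n$, appears twice in succession (in positions $l=2j-1$ and $l=2j$, when positions are indexed by $l=0,1,\dots,2n$), and $\widetilde{J}_n$ is the $(2n+1)\times(2n+1)$ matrix, indexed by $0\le k,l\le 2n$, whose $(k,l)$ entry is $1$ if $k-l\equiv \pm1 \pmod{2n+1}$ and $0$ otherwise.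
   Context: $\mathrm{diag}[b_0,\dots,b_{2n}]$ denotes the diagonal matrix with the listed diagonal entries and $^\top$ denotes transpose. The matrix $\widetilde{J}_n$ has ones on the first super- and sub-diagonals and in the top-right and bottom-left corners, and zeros elsewhere (including the main diagonal). *)

theory Defs
  imports
    Complex_Main
    "HOL-Number_Theory.Cong"
    "Jordan_Normal_Form.Matrix"
begin

definition Q_entry :: "nat \<Rightarrow> nat \<Rightarrow> nat \<Rightarrow> real" where
  "Q_entry n k l =
    (if l = 0 then real (2 * n + 1) powr (- 1 / 2)
     else if even l then
       real (2 * n + 1) powr (- 1 / 2) * sqrt 2 * cos (real l * real k * pi / real (2 * n + 1))
     else
       real (2 * n + 1) powr (- 1 / 2) * sqrt 2 * sin (real (l + 1) * real k * pi / real (2 * n + 1)))"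

definition Q_mat :: "nat \<Rightarrow> real mat" where
  "Q_mat n = mat (2 * n + 1) (2 * n + 1) (\<lambda>(k, l). Q_entry n k l)"

(* For j >= 1 both l = 2 j - 1 and l = 2 j satisfy (l + 1) div 2 = j. *)
definition eigenvalue_diag :: "nat \<Rightarrow> real mat" where
  "eigenvalue_diag n = mat_diag (2 * n + 1)
    (\<lambda>l. if l = 0 then 2
         else 2 * cos (2 * real ((l + 1) div 2) * pi / real (2 * n + 1)))"

definition J_tilde :: "nat \<Rightarrow> real mat" where
  "J_tilde n = mat (2 * n + 1) (2 * n + 1)
    (\<lambda>(k, l). if [int k - int l = 1] (mod int (2 * n + 1)) \<or>
                 [int k - int l = - 1] (mod int (2 * n + 1)) then 1 else 0)"

(* The library's orthogonal_mat only demands pairwise orthogonal nonzero columns, with no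
   normalisation; here the usual notion of a real orthogonal matrix is meant. *)
definition real_orthogonal_mat :: "real mat \<Rightarrow> bool" where
  "real_orthogonal_mat A \<longleftrightarrow>
    square_mat A \<and> inverts_mat A (transpose_mat A) \<and> inverts_mat (transpose_mat A) A"

end

theory Submission
  imports Defs "Jordan_Normal_Form.Determinant"
begin

text \<open>Write \<open>N = 2n + 1\<close>. The columns \<open>2j - 1\<close> and \<open>2j\<close> of \<open>Q_mat n\<close> sample a sine and a cosine of
  the same frequency \<open>2\<pi>j/N\<close>. Whenever a diagonal matrix carries the same weight \<open>c j\<close> in both
  positions, the identity \<open>cos a cos b + sin a sin b = cos (a - b)\<close> turns the entry
  \<open>(k, l)\<close> of \<open>Q diag[c] Q\<^sup>T\<close> into a cosine sum that depends on \<open>k - l\<close> only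
  (\<open>weighted_row_product\<close>). So both claims are statements about circulant matrices, and
  they follow from one evaluation: the Dirichlet kernel \<open>1 + 2 \<Sum>\<^sub>j cos (2\<pi>jm/N)\<close> is \<open>N\<close> if
  \<open>N\<close> divides \<open>m\<close> and \<open>0\<close> otherwise (\<open>dirichlet_kernel_at_roots\<close>).

  For the weights \<open>c j = 1\<close> this gives \<open>Q Q\<^sup>T = 1\<close>. For the eigenvalues \<open>c j = 2 cos (2\<pi>j/N)\<close>, the
  factor \<open>2 cos (2\<pi>j/N)\<close> shifts the argument \<open>m = k - l\<close> of the kernel by one in both
  directions, and the two shifted kernels, divided by \<open>N\<close>, are the indicators of
  \<open>k - l \<equiv> -1\<close> and \<open>k - l \<equiv> 1\<close> modulo \<open>N\<close>. They never fire together because \<open>N \<ge> 3\<close> does not divide \<open>2\<close>.\<close>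

definition dirichlet_kernel :: "nat \<Rightarrow> real \<Rightarrow> real" where
  "dirichlet_kernel n x = 1 + 2 * (\<Sum>j = 1..n. cos (real j * x))"

text \<open>The product formula for \<open>2 sin (x/2) cos (jx)\<close> makes the sum telescope.\<close>

lemma sin_half_times_dirichlet_kernel:
  "sin (x / 2) * dirichlet_kernel n x = sin ((real n + 1 / 2) * x)"
proof (induction n)
  case 0
  then show ?case by (simp add: dirichlet_kernel_def)
next
  case (Suc n)
  have "2 * sin (x / 2) * cos (real (Suc n) * x)
      = sin ((real (Suc n) + 1 / 2) * x) - sin ((real n + 1 / 2) * x)"
  proof -
    have "(real (Suc n) + 1 / 2) * x = real (Suc n) * x + x / 2"
      "(real n + 1 / 2) * x = real (Suc n) * x - x / 2"
      by (simp_all add: algebra_simps)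
    then show ?thesis
      by (simp only: sin_add sin_diff) (simp add: algebra_simps)
  qed
  moreover have "sin (x / 2) * dirichlet_kernel (Suc n) x
      = sin (x / 2) * dirichlet_kernel n x + 2 * sin (x / 2) * cos (real (Suc n) * x)"
    by (simp add: dirichlet_kernel_def algebra_simps)
  ultimately show ?case using Suc.IH by simp
qed

text \<open>At \<open>x = 2\<pi>m/(2n + 1)\<close> the right-hand side of the telescoped identity is \<open>sin (\<pi>m) = 0\<close>, so
  the kernel vanishes unless \<open>sin (x/2)\<close> does, and then every cosine equals \<open>1\<close>.\<close>

lemma dirichlet_kernel_at_roots:
  "dirichlet_kernel n (2 * pi * of_int m / real (2 * n + 1))
    = (if int (2 * n + 1) dvd m then real (2 * n + 1) else 0)"
proof (cases "int (2 * n + 1) dvd m")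
  case True
  then obtain q where m: "m = int (2 * n + 1) * q" by blast
  have "cos (real j * (2 * pi * of_int m / real (2 * n + 1))) = 1" for j
  proof -
    have "real j * (2 * pi * of_int m / real (2 * n + 1)) = 2 * pi * of_int (int j * q)"
      unfolding m by (simp add: field_simps)
    then show ?thesis using cos_int_2pin[of "int j * q"] by simp
  qed
  then show ?thesis using True by (simp add: dirichlet_kernel_def)
next
  case False
  define x where "x = 2 * pi * of_int m / real (2 * n + 1)"
  have "(real n + 1 / 2) * x = of_int m * pi"
    unfolding x_def by (simp add: field_simps)
  then have zero: "sin (x / 2) * dirichlet_kernel n x = 0"
    using sin_half_times_dirichlet_kernel[of x n] by (simp add: sin_zero_iff_int2)
  have "sin (x / 2) \<noteq> 0"
  proof
    assume "sin (x / 2) = 0"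
    then obtain i :: int where "x / 2 = of_int i * pi"
      by (auto simp: sin_zero_iff_int2)
    then have "pi * of_int m = pi * (of_int i * real (2 * n + 1))"
      unfolding x_def by (simp add: field_simps)
    then have "(of_int m :: real) = of_int i * real (2 * n + 1)"
      by (simp only: mult_left_cancel[OF pi_neq_zero])
    also have "\<dots> = of_int (i * int (2 * n + 1))" by simp
    finally have "m = i * int (2 * n + 1)" by (simp only: of_int_eq_iff)
    then show False using False by simp
  qed
  with zero have "dirichlet_kernel n x = 0" by simp
  then show ?thesis using False by (simp add: x_def)
qed

lemma sum_pair_odd_even:
  fixes f :: "nat \<Rightarrow> real"
  shows "(\<Sum>l < 2 * n + 1. f l) = f 0 + (\<Sum>j = 1..n. f (2 * j - 1) + f (2 * j))"
  by (induction n) simp_all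

text \<open>Since \<open>(l + 1) div 2\<close> is the frequency of column \<open>l\<close>, a weight that factors through it is
  shared by the sine and the cosine of each frequency, and the addition theorem applies.\<close>

lemma weighted_row_product:
  fixes c :: "nat \<Rightarrow> real"
  shows "(\<Sum>l < 2 * n + 1. Q_entry n k l * c ((l + 1) div 2) * Q_entry n k' l)
    = (c 0 + 2 * (\<Sum>j = 1..n. c j *
          cos (real j * (2 * pi * of_int (int k - int k') / real (2 * n + 1)))))
      / real (2 * n + 1)"
proof -
  let ?N = "real (2 * n + 1)"
  let ?s = "?N powr (- 1 / 2)"
  let ?f = "\<lambda>l. Q_entry n k l * c ((l + 1) div 2) * Q_entry n k' l"
  have s: "?s * ?s = 1 / ?N"
    by (simp add: powr_add[symmetric] powr_minus_divide)
  have pair: "?f (2 * j - 1) + ?f (2 * j)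
      = 2 / ?N * (c j * cos (real j * (2 * pi * of_int (int k - int k') / ?N)))"
    if "j \<in> {1..n}" for j
  proof -
    define a where "a = real (2 * j) * real k * pi / ?N"
    define b where "b = real (2 * j) * real k' * pi / ?N"
    from that have j: "j \<ge> 1" by simp
    have odd: "odd (2 * j - 1)" "2 * j - 1 + 1 = 2 * j" "2 * j - 1 \<noteq> 0" using j by auto
    have qs: "Q_entry n k (2 * j - 1) = ?s * sqrt 2 * sin a"
      "Q_entry n k' (2 * j - 1) = ?s * sqrt 2 * sin b"
      using odd unfolding Q_entry_def a_def b_def by (simp_all only: if_False)
    have qc: "Q_entry n k (2 * j) = ?s * sqrt 2 * cos a"
      "Q_entry n k' (2 * j) = ?s * sqrt 2 * cos b"
      using j unfolding Q_entry_def a_def b_def by simp_all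
    have freq: "(2 * j - 1 + 1) div 2 = j" "(2 * j + 1) div 2 = j" using j by auto
    have "?f (2 * j - 1) + ?f (2 * j)
        = (?s * ?s) * (sqrt 2 * sqrt 2) * c j * (cos a * cos b + sin a * sin b)"
      unfolding qs qc freq by (simp only: algebra_simps)
    also have "\<dots> = 2 / ?N * (c j * cos (a - b))"
      unfolding s by (simp add: cos_diff)
    also have "a - b = real j * (2 * pi * of_int (int k - int k') / ?N)"
      unfolding a_def b_def by (simp add: diff_divide_distrib[symmetric] algebra_simps)
    finally show ?thesis .
  qed
  have zero: "?f 0 = c 0 / ?N"
  proof -
    have "?f 0 = (?s * ?s) * c 0" by (simp add: Q_entry_def)
    then show ?thesis unfolding s by simp
  qed
  have "(\<Sum>l < 2 * n + 1. ?f l) = ?f 0 + (\<Sum>j = 1..n. ?f (2 * j - 1) + ?f (2 * j))"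
    by (rule sum_pair_odd_even)
  also have "\<dots> = c 0 / ?N + (\<Sum>j = 1..n.
      2 / ?N * (c j * cos (real j * (2 * pi * of_int (int k - int k') / ?N))))"
    unfolding zero by (intro arg_cong2[where f = "(+)"] refl sum.cong pair)
  also have "\<dots> = (c 0 + 2 * (\<Sum>j = 1..n. c j *
      cos (real j * (2 * pi * of_int (int k - int k') / ?N)))) / ?N"
    unfolding sum_distrib_left[symmetric] by (simp add: add_divide_distrib)
  finally show ?thesis .
qed

lemma Q_mat_carrier: "Q_mat n \<in> carrier_mat (2 * n + 1) (2 * n + 1)"
  by (simp add: Q_mat_def)

lemma Q_diag_Q_transpose_entry:
  assumes "k < 2 * n + 1" "k' < 2 * n + 1"
  shows "(Q_mat n * mat_diag (2 * n + 1) d * transpose_mat (Q_mat n)) $$ (k, k')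
    = (\<Sum>l < 2 * n + 1. Q_entry n k l * d l * Q_entry n k' l)"
  using assms
  by (subst mat_diag_mult_right[OF Q_mat_carrier])
    (simp add: Q_mat_def scalar_prod_def atLeast0LessThan)

lemma Q_mat_row_orthonormal: "Q_mat n * transpose_mat (Q_mat n) = 1\<^sub>m (2 * n + 1)"
proof (rule eq_matI)
  fix k k' assume "k < dim_row (1\<^sub>m (2 * n + 1) :: real mat)" "k' < dim_col (1\<^sub>m (2 * n + 1) :: real mat)"
  then have lt: "k < 2 * n + 1" "k' < 2 * n + 1" by auto
  have "(Q_mat n * transpose_mat (Q_mat n)) $$ (k, k')
      = (\<Sum>l < 2 * n + 1. Q_entry n k l * 1 * Q_entry n k' l)"
    using lt by (simp add: Q_mat_def scalar_prod_def atLeast0LessThan)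
  also have "\<dots> = dirichlet_kernel n (2 * pi * of_int (int k - int k') / real (2 * n + 1))
      / real (2 * n + 1)"
    using weighted_row_product[where c = "\<lambda>_. 1"] by (simp add: dirichlet_kernel_def)
  also have "\<dots> = (if int (2 * n + 1) dvd int k - int k' then 1 else 0)"
    unfolding dirichlet_kernel_at_roots by simp
  also have "int (2 * n + 1) dvd int k - int k' \<longleftrightarrow> k = k'"
  proof -
    have "int (2 * n + 1) dvd int k - int k' \<longleftrightarrow> int k mod int (2 * n + 1) = int k' mod int (2 * n + 1)"
      by (simp only: mod_eq_dvd_iff)
    also have "\<dots> \<longleftrightarrow> k = k'"
      unfolding zmod_int[symmetric] using lt by simp
    finally show ?thesis .
  qed
  finally show "(Q_mat n * transpose_mat (Q_mat n)) $$ (k, k') = 1\<^sub>m (2 * n + 1) $$ (k, k')"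
    using lt by simp
qed (simp_all add: Q_mat_def)

text \<open>Square matrices have two-sided inverses, so orthonormality of the rows suffices.\<close>

lemma Q_mat_orthogonal: "real_orthogonal_mat (Q_mat n)"
proof -
  have T: "transpose_mat (Q_mat n) \<in> carrier_mat (2 * n + 1) (2 * n + 1)"
    using Q_mat_carrier by simp
  have "transpose_mat (Q_mat n) * Q_mat n = 1\<^sub>m (2 * n + 1)"
    using mat_mult_left_right_inverse[OF Q_mat_carrier T Q_mat_row_orthonormal] .
  then show ?thesis
    using Q_mat_row_orthonormal[of n] Q_mat_carrier[of n]
    by (auto simp: real_orthogonal_mat_def inverts_mat_def)
qed

text \<open>This is the product-to-sum formula, applied to each frequency. At \<open>y = 2\<pi>/(2n + 1)\<close> it turns
  the eigenvalues into the two neighbour shifts of a cyclic adjacency matrix.\<close>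

lemma cos_weighted_dirichlet_kernel:
  "2 + 2 * (\<Sum>j = 1..n. 2 * cos (real j * y) * cos (real j * x))
    = dirichlet_kernel n (x + y) + dirichlet_kernel n (x - y)"
proof -
  have "2 * cos (real j * y) * cos (real j * x) = cos (real j * (x + y)) + cos (real j * (x - y))"
    for j by (simp add: distrib_left right_diff_distrib cos_add cos_diff)
  then show ?thesis by (simp add: dirichlet_kernel_def sum.distrib)
qed

lemma Q_mat_diagonalizes_J_tilde:
  assumes "n \<ge> 1"
  shows "Q_mat n * eigenvalue_diag n * transpose_mat (Q_mat n) = J_tilde n"
proof (rule eq_matI)
  fix k k' assume "k < dim_row (J_tilde n)" "k' < dim_col (J_tilde n)"
  then have lt: "k < 2 * n + 1" "k' < 2 * n + 1" by (auto simp: J_tilde_def)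
  let ?N = "real (2 * n + 1)"
  let ?m = "int k - int k'"
  define c where "c = (\<lambda>j. 2 * cos (real j * (2 * pi / ?N)))"
  \<comment> \<open>The leading eigenvalue \<open>2\<close> is the value of the same formula at frequency \<open>0\<close>.\<close>
  have eig: "eigenvalue_diag n = mat_diag (2 * n + 1) (\<lambda>l. c ((l + 1) div 2))"
    unfolding eigenvalue_diag_def c_def
    by (rule arg_cong[where f = "mat_diag (2 * n + 1)"]) (auto simp: fun_eq_iff mult_ac)
  have shift: "2 * pi * of_int ?m / ?N + 2 * pi / ?N = 2 * pi * of_int (?m + 1) / ?N"
    "2 * pi * of_int ?m / ?N - 2 * pi / ?N = 2 * pi * of_int (?m - 1) / ?N"
    by (simp_all add: add_divide_distrib[symmetric] diff_divide_distrib[symmetric] algebra_simps)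
  have "(Q_mat n * eigenvalue_diag n * transpose_mat (Q_mat n)) $$ (k, k')
      = (c 0 + 2 * (\<Sum>j = 1..n. c j * cos (real j * (2 * pi * of_int ?m / ?N)))) / ?N"
    unfolding eig Q_diag_Q_transpose_entry[OF lt] by (rule weighted_row_product)
  also have "\<dots> = (dirichlet_kernel n (2 * pi * of_int (?m + 1) / ?N)
      + dirichlet_kernel n (2 * pi * of_int (?m - 1) / ?N)) / ?N"
    unfolding shift[symmetric] cos_weighted_dirichlet_kernel[symmetric] by (simp add: c_def)
  also have "\<dots> = (if int (2 * n + 1) dvd ?m + 1 then 1 else 0)
      + (if int (2 * n + 1) dvd ?m - 1 then 1 else 0)"
    unfolding dirichlet_kernel_at_roots by (simp add: add_divide_distrib)
  also have "\<dots> = (if int (2 * n + 1) dvd ?m - 1 \<or> int (2 * n + 1) dvd ?m + 1 then 1 else 0)"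
  proof -
    have "\<not> (int (2 * n + 1) dvd ?m + 1 \<and> int (2 * n + 1) dvd ?m - 1)"
    proof
      assume "int (2 * n + 1) dvd ?m + 1 \<and> int (2 * n + 1) dvd ?m - 1"
      then have "int (2 * n + 1) dvd (?m + 1) - (?m - 1)" using dvd_diff by blast
      then have "int (2 * n + 1) dvd 2" by simp
      then have "int (2 * n + 1) \<le> 2" by (rule zdvd_imp_le) simp
      then show False using assms by simp
    qed
    then show ?thesis by auto
  qed
  finally show "(Q_mat n * eigenvalue_diag n * transpose_mat (Q_mat n)) $$ (k, k')
      = J_tilde n $$ (k, k')"
    using lt by (simp add: J_tilde_def cong_iff_dvd_diff)
qed (simp_all add: Q_mat_def J_tilde_def)

theorem lemma3p1:
  fixes n :: nat
  assumes "n \<ge> 1"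
  shows "real_orthogonal_mat (Q_mat n) \<and>
    Q_mat n * eigenvalue_diag n * transpose_mat (Q_mat n) = J_tilde n"
  using Q_mat_orthogonal Q_mat_diagonalizes_J_tilde[OF assms] by blast

end
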